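(* Let $X$ be a real Banach space with duality map $J$, let $A$ generate a $C_0$-semigroup $S(t)$ of isometries on $X$, and let $B$ be a bounded linear operator on $X$. Suppose that the mapping $B_J:y\mapsto\langle By,J(y)\rangle$ is single-valued and satisfies $$|B_J(y)-B_J(z)|\le\mathcal{K}(\|y\|,\|z\|)\,\|y-z\|,\qquad\forall y,z\in X,$$ where $\mathcal{K}:\mathbb{R}^+\times\mathbb{R}^+\to\mathbb{R}^+$ is increasing (i.e. $0\le s_1\le r_1$ and $0\le s_2\le r_2$ imply $\mathcal{K}(s_1,s_2)\le\mathcal{K}(r_1,r_2)$), $s\mapsto\mathcal{K}(s,s)$ is continuous, and $\mathcal{K}(s,s)\le Cs$ for all $s\ge0$, for some $C>0$. Consider the system $$\frac{dz(t)}{dt}=Az(t)+u(t)Bz(t),\qquad z(0)=z_0\in X,$$ with the feedback control $$u(t)=-\lambda\frac{\langle Bz(t),J(z(t))\rangle}{\|z(t)\|^2}\ \text{ if } z(t)\ne0,\qquad u(t)=0\ \text{ if } z(t)=0.$$ If this control uniformly exponentially stabilizes the system for some $\lambda>0$, then there exist $T,\delta>0$ such that $$\int_0^T|\langle BS(t)y,J(S(t)y)\rangle|\,dt\ge\delta\|S(T)y\|^2,\qquad\forall y\in X.$$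
   Context: $\langle y,\phi\rangle$ denotes the duality pairing of $y\in X$ and $\phi\in X^*$. The duality map is $J(y)=\{\phi\in X^*:\ \langle y,\phi\rangle=\|y\|^2=\|\phi\|^2\}$, in general multi-valued. That $B_J$ is single-valued means that $\langle By,y^*\rangle$ takes the same value for all $y^*\in J(y)$; this common value is denoted $\langle By,J(y)\rangle$. A semigroup of isometries satisfies $\|S(t)y\|=\|y\|$ for all $t\ge0$, $y\in X$. The feedback uniformly exponentially stabilizes the system if there are constants $M,\sigma>0$ such that for every $z_0\in X$ the closed-loop system has a unique mild solution $z$ on $[0,+\infty)$ (i.e. continuous with $z(t)=S(t)z_0+\int_0^tS(t-s)u(s)Bz(s)\,ds$, $u$ being the feedback evaluated along $z$) and $\|z(t)\|\le Me^{-\sigma t}\|z_0\|$ for all $t\ge0$. *)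

theory Defs
  imports "HOL-Analysis.Analysis"
begin

definition duality_map :: "'a::real_normed_vector \<Rightarrow> ('a \<Rightarrow>\<^sub>L real) set" where
  "duality_map y =
     {\<phi>. blinfun_apply \<phi> y = (norm y)\<^sup>2 \<and> (norm \<phi>)\<^sup>2 = (norm y)\<^sup>2}"

definition BJ_single_valued :: "('a::real_normed_vector \<Rightarrow>\<^sub>L 'a) \<Rightarrow> bool" where
  "BJ_single_valued B \<longleftrightarrow>
     (\<forall>y. \<forall>\<phi>\<in>duality_map y. \<forall>\<psi>\<in>duality_map y.
        blinfun_apply \<phi> (blinfun_apply B y) = blinfun_apply \<psi> (blinfun_apply B y))"

text \<open>The common value of the pairings of \<open>B y\<close> with the elements of the duality map at \<open>y\<close>.
  It is meaningful only under \<open>BJ_single_valued B\<close>; the duality map is never empty,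
  by the Hahn-Banach theorem.\<close>

definition BJ :: "('a::real_normed_vector \<Rightarrow>\<^sub>L 'a) \<Rightarrow> 'a \<Rightarrow> real" where
  "BJ B y = (THE c. \<exists>\<phi>\<in>duality_map y. c = blinfun_apply \<phi> (blinfun_apply B y))"

text \<open>Semigroups are functions on all of \<open>real\<close>; only their values at
  nonnegative times are ever constrained or used.\<close>

definition C0_semigroup :: "(real \<Rightarrow> ('a::real_normed_vector \<Rightarrow>\<^sub>L 'a)) \<Rightarrow> bool" where
  "C0_semigroup S \<longleftrightarrow>
     S 0 = id_blinfun \<and>
     (\<forall>s\<ge>0. \<forall>t\<ge>0. S (s + t) = S s o\<^sub>L S t) \<and>
     (\<forall>y. ((\<lambda>t. blinfun_apply (S t) y) \<longlongrightarrow> y) (at_right 0))"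

text \<open>The unbounded operator \<open>A\<close> with domain \<open>D\<close> is the infinitesimal generator of \<open>S\<close>;
  the values of \<open>A\<close> outside \<open>D\<close> are irrelevant.\<close>

definition generates_C0_semigroup ::
  "'a::real_normed_vector set \<Rightarrow> ('a \<Rightarrow> 'a) \<Rightarrow> (real \<Rightarrow> ('a \<Rightarrow>\<^sub>L 'a)) \<Rightarrow> bool" where
  "generates_C0_semigroup D A S \<longleftrightarrow>
     C0_semigroup S \<and>
     D = {y. \<exists>l. ((\<lambda>h. (blinfun_apply (S h) y - y) /\<^sub>R h) \<longlongrightarrow> l) (at_right 0)} \<and>
     (\<forall>y\<in>D. ((\<lambda>h. (blinfun_apply (S h) y - y) /\<^sub>R h) \<longlongrightarrow> A y) (at_right 0))"

definition isometric_semigroup :: "(real \<Rightarrow> ('a::real_normed_vector \<Rightarrow>\<^sub>L 'a)) \<Rightarrow> bool" where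
  "isometric_semigroup S \<longleftrightarrow> (\<forall>t\<ge>0. \<forall>y. norm (blinfun_apply (S t) y) = norm y)"

definition feedback :: "real \<Rightarrow> ('a::real_normed_vector \<Rightarrow>\<^sub>L 'a) \<Rightarrow> 'a \<Rightarrow> real" where
  "feedback lam B y = (if y = 0 then 0 else - lam * (BJ B y / (norm y)\<^sup>2))"

text \<open>Mild solution on \<open>[0, \<infinity>)\<close> of \<open>z' = A z + F z B z\<close>, \<open>z 0 = z0\<close>, where \<open>S\<close> is the semigroup
  generated by \<open>A\<close> and \<open>F\<close> is a state feedback, so that the control is \<open>u s = F (z s)\<close>.
  The integral is the vector-valued Henstock-Kurzweil integral.\<close>

definition mild_solution ::
  "(real \<Rightarrow> ('a::banach \<Rightarrow>\<^sub>L 'a)) \<Rightarrow> ('a \<Rightarrow>\<^sub>L 'a) \<Rightarrow> ('a \<Rightarrow> real) \<Rightarrow> 'a \<Rightarrow> (real \<Rightarrow> 'a) \<Rightarrow> bool" where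
  "mild_solution S B F z0 z \<longleftrightarrow>
     continuous_on {0..} z \<and>
     (\<forall>t\<ge>0.
        (\<lambda>s. blinfun_apply (S (t - s)) (F (z s) *\<^sub>R blinfun_apply B (z s))) integrable_on {0..t} \<and>
        z t = blinfun_apply (S t) z0 +
          integral {0..t} (\<lambda>s. blinfun_apply (S (t - s)) (F (z s) *\<^sub>R blinfun_apply B (z s))))"

text \<open>Uniqueness of the solution is uniqueness on \<open>[0, \<infinity>)\<close>, since a solution is a function
  on all of \<open>real\<close> whose values at negative times are arbitrary.\<close>

definition unif_exp_stabilizes ::
  "(real \<Rightarrow> ('a::banach \<Rightarrow>\<^sub>L 'a)) \<Rightarrow> ('a \<Rightarrow>\<^sub>L 'a) \<Rightarrow> ('a \<Rightarrow> real) \<Rightarrow> bool" where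
  "unif_exp_stabilizes S B F \<longleftrightarrow>
     (\<exists>M>0. \<exists>\<sigma>>0. \<forall>z0. \<exists>z.
        mild_solution S B F z0 z \<and>
        (\<forall>w. mild_solution S B F z0 w \<longrightarrow> (\<forall>t\<ge>0. w t = z t)) \<and>
        (\<forall>t\<ge>0. norm (z t) \<le> M * exp (- \<sigma> * t) * norm z0))"

end

theory Submission
  imports Defs
begin

text \<open>
  Write \<open>b\<close> for \<open>BJ B\<close>, and let \<open>z\<close> be a closed-loop solution starting at \<open>y \<noteq> 0\<close>. The free orbit
  keeps the norm \<open>\<parallel>y\<parallel>\<close>, whereas exponential stability makes \<open>\<parallel>z T\<parallel> \<le> \<parallel>y\<parallel> / 2\<close> for a time \<open>T\<close> that
  does not depend on \<open>y\<close>. So the deviation \<open>w t = \<parallel>z t - S t y\<parallel>\<close>, which vanishes at time 0, has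
  to reach \<open>\<parallel>y\<parallel> / 2\<close> by time \<open>T\<close>. Only the feedback can cause this, and the feedback is controlled
  by \<open>\<bar>b\<bar>\<close> along the solution; the Lipschitz condition replaces it by \<open>\<bar>b\<bar>\<close> along the free orbit,
  at the price of a term proportional to \<open>w\<close>.

  The feedback carries a division by \<open>\<parallel>z t\<parallel>\<^sup>2\<close>, which could be harmful where \<open>z\<close> is small. This
  is avoided by stopping at the first time \<open>\<tau>\<close> with \<open>w \<tau> = \<parallel>y\<parallel> / 2\<close> (lemma
  \<open>first_hitting_time\<close>): up to \<open>\<tau>\<close> the norm of \<open>z\<close> stays between \<open>\<parallel>y\<parallel> / 2\<close> and \<open>3 \<parallel>y\<parallel> / 2\<close>, and
  the mild formulation gives, with \<open>a\<close> any positive upper bound of \<open>lam * \<parallel>B\<parallel>\<close>,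

    \<open>w t \<le> (2 * a / \<parallel>y\<parallel>) * (\<integral>\<^sub>0\<^sup>t \<bar>b (S s y)\<bar> ds) + 3 * a * C * (\<integral>\<^sub>0\<^sup>t w s ds)\<close> for \<open>0 \<le> t \<le> \<tau>\<close>.

  Gronwall's inequality at \<open>t = \<tau>\<close> then reads
  \<open>\<parallel>y\<parallel> / 2 \<le> (2 * a / \<parallel>y\<parallel>) * (\<integral>\<^sub>0\<^sup>T \<bar>b (S s y)\<bar> ds) * exp (3 * a * C * T)\<close>, which is the observability
  inequality (lemma \<open>observability_of_decaying_solution\<close>).
\<close>

section \<open>Scalar functions on an interval\<close>

lemma gronwall:
  fixes w :: "real \<Rightarrow> real"
  assumes cont: "continuous_on {0..\<tau>} w" and "0 \<le> \<tau>" and "0 \<le> k"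
    and le: "\<And>t. t \<in> {0..\<tau>} \<Longrightarrow> w t \<le> c + k * integral {0..t} w"
  shows "w \<tau> \<le> c * exp (k * \<tau>)"
proof -
  \<comment> \<open>The hypothesis says that the right-hand side, multiplied by this exponential, is nonincreasing.\<close>
  define \<phi> where "\<phi> = (\<lambda>t. (c + k * integral {0..t} w) * exp (- k * t))"
  have deriv: "(\<phi> has_real_derivative
      (k * w t - k * (c + k * integral {0..t} w)) * exp (- k * t)) (at t)"
    if "0 < t" "t < \<tau>" for t
  proof -
    have "((\<lambda>u. integral {0..u} w) has_real_derivative w t) (at t within {0..\<tau>})"
      using integral_has_real_derivative[OF cont, of t] that by simp
    moreover have "at t within {0..\<tau>} = at t"
      by (rule at_within_interior) (use that in auto)
    ultimately have "((\<lambda>u. integral {0..u} w) has_real_derivative w t) (at t)"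
      by simp
    then show ?thesis
      unfolding \<phi>_def by (auto intro!: derivative_eq_intros simp: algebra_simps)
  qed
  have "\<phi> \<tau> \<le> \<phi> 0"
  proof (rule DERIV_nonpos_imp_decreasing_open[OF \<open>0 \<le> \<tau>\<close>])
    fix t assume t: "0 < t" "t < \<tau>"
    have "k * w t \<le> k * (c + k * integral {0..t} w)"
      using le[of t] t \<open>0 \<le> k\<close> by (intro mult_left_mono) auto
    then have "(k * w t - k * (c + k * integral {0..t} w)) * exp (- k * t) \<le> 0"
      by (intro mult_nonpos_nonneg) auto
    then show "\<exists>d. (\<phi> has_real_derivative d) (at t) \<and> d \<le> 0"
      using deriv[OF t] by blast
  next
    show "continuous_on {0..\<tau>} \<phi>"
      unfolding \<phi>_def
      by (intro continuous_intros indefinite_integral_continuous_1 integrable_continuous_interval cont)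
  qed
  then have "(c + k * integral {0..\<tau>} w) * exp (- k * \<tau>) * exp (k * \<tau>) \<le> c * exp (k * \<tau>)"
    by (simp add: \<phi>_def)
  then have "c + k * integral {0..\<tau>} w \<le> c * exp (k * \<tau>)"
    by (simp add: mult.assoc flip: exp_add)
  then show ?thesis
    using le[of \<tau>] \<open>0 \<le> \<tau>\<close> by simp
qed

lemma first_hitting_time:
  fixes w :: "real \<Rightarrow> real"
  assumes cont: "continuous_on {0..T} w" and "0 \<le> T" and "w 0 \<le> r" and "r \<le> w T"
  obtains \<tau> where "\<tau> \<in> {0..T}" and "w \<tau> = r" and "\<And>t. t \<in> {0..\<tau>} \<Longrightarrow> w t \<le> r"
proof -
  define E where "E = {t \<in> {0..T}. r \<le> w t}"
  have "closed E"
    using continuous_on_closed_Collect_le[OF continuous_on_const cont, of r] by (simp add: E_def)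
  then have "compact ({0..T} \<inter> E)"
    by (intro compact_Int_closed) auto
  moreover have "{0..T} \<inter> E = E"
    by (auto simp: E_def)
  ultimately have "compact E" by simp
  moreover have "E \<noteq> {}"
    using assms by (auto simp: E_def)
  ultimately obtain \<tau> where \<tau>: "\<tau> \<in> E" and least: "\<And>t. t \<in> E \<Longrightarrow> \<tau> \<le> t"
    using compact_attains_inf[of E] by blast
  have "continuous_on {0..\<tau>} w"
    using cont \<tau> by (auto simp: E_def intro: continuous_on_subset)
  then obtain x where "0 \<le> x" "x \<le> \<tau>" "w x = r"
    using IVT'[of w 0 r \<tau>] \<tau> assms by (auto simp: E_def)
  moreover have "\<tau> \<le> x"
    using least[of x] calculation \<tau> by (auto simp: E_def)
  ultimately have "w \<tau> = r" by simp
  moreover have "w t \<le> r" if "t \<in> {0..\<tau>}" for t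
    using least[of t] that \<tau> \<open>w \<tau> = r\<close> by (cases "t = \<tau>") (force simp: E_def)+
  ultimately show ?thesis
    using that \<tau> by (auto simp: E_def)
qed

section \<open>Free orbits and the feedback\<close>

lemma isometric_orbit_continuous:
  fixes S :: "real \<Rightarrow> ('a::real_normed_vector \<Rightarrow>\<^sub>L 'a)"
  assumes C0: "C0_semigroup S" and iso: "isometric_semigroup S"
  shows "continuous_on {0..} (\<lambda>t. S t y)"
proof -
  \<comment> \<open>An isometric semigroup makes the modulus of continuity the same at every time, so that
    right continuity at 0 is enough.\<close>
  have diff: "norm (S t y - S s y) = norm (S (t - s) y - y)" if "0 \<le> s" "s \<le> t" for s t
  proof -
    have "S (s + (t - s)) = S s o\<^sub>L S (t - s)"
      using C0 that unfolding C0_semigroup_def by (metis diff_ge_0_iff_ge)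
    then have "S t y - S s y = S s (S (t - s) y - y)"
      by (simp add: blinfun.diff_right)
    then show ?thesis
      using iso that by (simp add: isometric_semigroup_def)
  qed
  show ?thesis
    unfolding continuous_on_iff
  proof (intro ballI allI impI)
    fix t e :: real assume t: "t \<in> {0..}" and "0 < e"
    have "((\<lambda>h. S h y) \<longlongrightarrow> y) (at_right 0)"
      using C0 by (simp add: C0_semigroup_def)
    then have "\<forall>\<^sub>F h in at_right 0. dist (S h y) y < e"
      using \<open>0 < e\<close> by (rule tendstoD)
    then obtain d where "0 < d" and d: "\<And>h. 0 < h \<Longrightarrow> h < d \<Longrightarrow> dist (S h y) y < e"
      by (auto simp: eventually_at_right_field)
    have "dist (S s y) (S t y) < e" if "s \<in> {0..}" "dist s t < d" for s
    proof (cases s t rule: linorder_cases)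
      case less
      then show ?thesis
        using diff[of s t] d[of "t - s"] that by (simp add: dist_norm norm_minus_commute)
    next
      case equal
      then show ?thesis using \<open>0 < e\<close> by simp
    next
      case greater
      then show ?thesis
        using diff[of t s] d[of "s - t"] that t by (simp add: dist_norm)
    qed
    then show "\<exists>d>0. \<forall>s\<in>{0..}. dist s t < d \<longrightarrow> dist (S s y) (S t y) < e"
      using \<open>0 < d\<close> by blast
  qed
qed

lemma continuous_on_of_lipschitz_on_balls:
  fixes f :: "'a::real_normed_vector \<Rightarrow> 'b::real_normed_vector"
  assumes "\<And>x y m. norm x \<le> m \<Longrightarrow> norm y \<le> m \<Longrightarrow> norm (f x - f y) \<le> C * m * norm (x - y)"
    and "0 \<le> C"
  shows "continuous_on UNIV f"
proof -
  have "continuous_on (ball 0 m) f" if "0 \<le> m" for m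
    using assms that
    by (intro lipschitz_on_continuous_on[of "C * m"] lipschitz_onI) (auto simp: dist_norm)
  then have "continuous_on (\<Union>m\<in>{0..}. ball 0 m) f"
    by (intro continuous_on_open_UN) auto
  moreover have "x \<in> (\<Union>m\<in>{0..}. ball 0 m)" for x :: 'a
    by (rule UN_I[of "norm x + 1"]) auto
  then have "(\<Union>m\<in>{0..}. ball (0::'a) m) = UNIV"
    by blast
  ultimately show ?thesis by simp
qed

lemma norm_feedback_scaleR_le:
  assumes "0 \<le> lam"
  shows "norm (feedback lam B x *\<^sub>R B x) \<le> lam * norm B * (\<bar>BJ B x\<bar> / norm x)"
proof (cases "x = 0")
  case False
  have "norm (feedback lam B x *\<^sub>R B x) \<le> lam * \<bar>BJ B x\<bar> / (norm x)\<^sup>2 * (norm B * norm x)"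
    using False assms norm_blinfun[of B x]
    by (auto simp: feedback_def abs_mult intro!: mult_left_mono divide_right_mono)
  also have "\<dots> = lam * norm B * (\<bar>BJ B x\<bar> / norm x)"
    using False by (simp add: power2_eq_square)
  finally show ?thesis .
qed (simp add: feedback_def)

section \<open>Observability from decay\<close>

text \<open>
  The factor of \<open>(norm y)\<^sup>2\<close> depends on the solution only through the time \<open>T\<close> at which it has lost
  half of its norm; uniform stability provides a common \<open>T\<close>, hence a common factor. Allowing \<open>a\<close>
  to exceed \<open>lam * norm B\<close> keeps this factor positive when \<open>B = 0\<close>.
\<close>

lemma observability_of_decaying_solution:
  fixes S :: "real \<Rightarrow> ('a::banach \<Rightarrow>\<^sub>L 'a)"
  assumes C0: "C0_semigroup S" and iso: "isometric_semigroup S"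
    and lip: "\<And>x y m. norm x \<le> m \<Longrightarrow> norm y \<le> m \<Longrightarrow>
        \<bar>BJ B x - BJ B y\<bar> \<le> C * m * norm (x - y)" and "0 \<le> C"
    and sol: "mild_solution S B (feedback lam B) y z"
    and "0 \<le> lam" and a: "lam * norm B \<le> a" "0 < a"
    and "0 \<le> T" and decay: "norm (z T) \<le> norm y / 2"
  shows "exp (- (3 * a * C * T)) / (4 * a) * (norm y)\<^sup>2 \<le> integral {0..T} (\<lambda>t. \<bar>BJ B (S t y)\<bar>)"
proof (cases "y = 0")
  case True
  then show ?thesis
    by (cases "(\<lambda>t. \<bar>BJ B (S t y)\<bar>) integrable_on {0..T}")
       (auto intro: integral_nonneg simp: not_integrable_integral)
next
  case False
  then have y: "0 < norm y" by simp
  define w where "w = (\<lambda>t. norm (z t - S t y))"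
  define f where "f = (\<lambda>t. \<bar>BJ B (S t y)\<bar>)"
  have norm_orbit: "norm (S t y) = norm y" if "0 \<le> t" for t
    using iso that by (simp add: isometric_semigroup_def)
  have cont_orbit: "continuous_on {0..} (\<lambda>t. S t y)"
    using C0 iso by (rule isometric_orbit_continuous)
  have cont_on: "continuous_on {0..t} h" if "continuous_on {0..} h" for t and h :: "real \<Rightarrow> real"
    using that by (rule continuous_on_subset) auto
  have "continuous_on UNIV (BJ B)"
    using lip \<open>0 \<le> C\<close> by (intro continuous_on_of_lipschitz_on_balls[of _ C]) auto
  then have cont_f: "continuous_on {0..} f"
    unfolding f_def
    by (intro continuous_intros continuous_on_compose2[OF _ cont_orbit]) auto
  have cont_w: "continuous_on {0..} w"
    using sol cont_orbit unfolding w_def mild_solution_def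
    by (intro continuous_on_norm continuous_on_diff) auto

  \<comment> \<open>Decay of \<open>z\<close> and conservation of the norm by \<open>S\<close> force the two trajectories apart.\<close>
  have "w 0 = 0"
    using sol C0 by (simp add: w_def mild_solution_def C0_semigroup_def)
  moreover have "norm y / 2 \<le> w T"
    using norm_triangle_ineq2[of "S T y" "z T"] decay norm_orbit[OF \<open>0 \<le> T\<close>]
    by (simp add: w_def norm_minus_commute)
  ultimately obtain \<tau> where \<tau>: "\<tau> \<in> {0..T}" and w\<tau>: "w \<tau> = norm y / 2"
    and small: "\<And>t. t \<in> {0..\<tau>} \<Longrightarrow> w t \<le> norm y / 2"
    using first_hitting_time[OF cont_on[OF cont_w, of T] \<open>0 \<le> T\<close>, of "norm y / 2"] by auto

  \<comment> \<open>Up to \<open>\<tau>\<close> both trajectories lie in the ball of radius \<open>3 / 2 * norm y\<close>, where the Lipschitz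
    condition is applied, and the lower bound on \<open>norm (z s)\<close> makes the division harmless.\<close>
  have control: "norm (feedback lam B (z s) *\<^sub>R B (z s)) \<le> 2 * a / norm y * f s + 3 * a * C * w s"
    if s: "s \<in> {0..\<tau>}" for s
  proof -
    have lower: "norm y / 2 \<le> norm (z s)"
      using norm_triangle_ineq2[of "S s y" "z s"] small[OF s] norm_orbit[of s] s
      by (simp add: w_def norm_minus_commute)
    have upper: "norm (z s) \<le> 3 / 2 * norm y"
      using norm_triangle_ineq[of "z s - S s y" "S s y"] small[OF s] norm_orbit[of s] s
      by (simp add: w_def)
    have "\<bar>BJ B (z s) - BJ B (S s y)\<bar> \<le> C * (3 / 2 * norm y) * w s"
      unfolding w_def using upper norm_orbit[of s] s by (intro lip) auto
    then have b: "\<bar>BJ B (z s)\<bar> \<le> f s + C * (3 / 2 * norm y) * w s"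
      unfolding f_def by linarith
    have "norm (feedback lam B (z s) *\<^sub>R B (z s)) \<le> lam * norm B * (\<bar>BJ B (z s)\<bar> / norm (z s))"
      using \<open>0 \<le> lam\<close> by (rule norm_feedback_scaleR_le)
    also have "\<dots> \<le> a * ((f s + C * (3 / 2 * norm y) * w s) / (norm y / 2))"
      using a b lower y by (intro mult_mono frac_le) auto
    also have "\<dots> = 2 * a / norm y * f s + 3 * a * C * w s"
      using y by (simp add: field_simps)
    finally show ?thesis .
  qed

  define c where "c = 2 * a / norm y * integral {0..T} f"
  have "w t \<le> c + 3 * a * C * integral {0..t} w" if t: "t \<in> {0..\<tau>}" for t
  proof -
    have int_w: "w integrable_on {0..t}" and int_f: "f integrable_on {0..t}"
      and int_fT: "f integrable_on {0..T}"
      by (intro integrable_continuous_interval cont_on cont_w cont_f)+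
    let ?g = "\<lambda>s. S (t - s) (feedback lam B (z s) *\<^sub>R B (z s))"
    let ?h = "\<lambda>s. 2 * a / norm y * f s + 3 * a * C * w s"
    have "w t = norm (integral {0..t} ?g)"
      using sol t by (simp add: w_def mild_solution_def)
    also have "\<dots> \<le> integral {0..t} ?h"
    proof (rule integral_norm_bound_integral)
      show "?g integrable_on {0..t}"
        using sol t by (simp add: mild_solution_def)
      show "?h integrable_on {0..t}"
        by (intro integrable_add integrable_on_mult_right int_w int_f)
      show "norm (?g s) \<le> ?h s" if "s \<in> {0..t}" for s
        using control[of s] that t iso by (simp add: isometric_semigroup_def)
    qed
    also have "\<dots> = 2 * a / norm y * integral {0..t} f + 3 * a * C * integral {0..t} w"
      by (simp only: integral_add integrable_on_mult_right int_w int_f integral_mult_right)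
    also have "\<dots> \<le> c + 3 * a * C * integral {0..t} w"
    proof -
      have "integral {0..t} f \<le> integral {0..T} f"
        using t \<tau> int_f int_fT by (intro integral_subset_le) (auto simp: f_def)
      then have "2 * a / norm y * integral {0..t} f \<le> c"
        unfolding c_def using a by (intro mult_left_mono) auto
      then show ?thesis by simp
    qed
    finally show ?thesis .
  qed
  then have "w \<tau> \<le> c * exp (3 * a * C * \<tau>)"
    using \<tau> a \<open>0 \<le> C\<close> by (intro gronwall cont_on cont_w) auto
  also have "\<dots> \<le> c * exp (3 * a * C * T)"
  proof (rule mult_left_mono)
    have "0 \<le> integral {0..T} f"
      by (intro integral_nonneg integrable_continuous_interval cont_on cont_f) (simp add: f_def)
    then show "0 \<le> c"
      using a by (simp add: c_def)
    show "exp (3 * a * C * \<tau>) \<le> exp (3 * a * C * T)"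
      using \<tau> a \<open>0 \<le> C\<close> by (auto intro!: mult_left_mono)
  qed
  finally have "norm y / 2 \<le> 2 * a / norm y * integral {0..T} f * exp (3 * a * C * T)"
    by (simp add: w\<tau> c_def)
  then have "(norm y)\<^sup>2 \<le> 4 * a * (integral {0..T} f * exp (3 * a * C * T))"
    using y by (simp add: field_simps power2_eq_square)
  then show ?thesis
    using a by (simp add: f_def exp_minus field_simps)
qed

theorem theorem7p2:
  fixes S :: "real \<Rightarrow> ('a::banach \<Rightarrow>\<^sub>L 'a)"
    and D :: "'a set"
    and A :: "'a \<Rightarrow> 'a"
    and B :: "'a \<Rightarrow>\<^sub>L 'a"
    and K :: "real \<Rightarrow> real \<Rightarrow> real"
    and C :: real
  assumes "generates_C0_semigroup D A S"
    and "isometric_semigroup S"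
    and "BJ_single_valued B"
    and "\<And>y z. \<bar>BJ B y - BJ B z\<bar> \<le> K (norm y) (norm z) * norm (y - z)"
    and "\<And>s r. 0 \<le> s \<Longrightarrow> 0 \<le> r \<Longrightarrow> 0 \<le> K s r"
    and "\<And>s1 r1 s2 r2. 0 \<le> s1 \<Longrightarrow> s1 \<le> r1 \<Longrightarrow> 0 \<le> s2 \<Longrightarrow> s2 \<le> r2 \<Longrightarrow> K s1 s2 \<le> K r1 r2"
    and "continuous_on {0..} (\<lambda>s. K s s)"
    and "0 < C" and "\<And>s. 0 \<le> s \<Longrightarrow> K s s \<le> C * s"
    and "\<exists>lam>0. unif_exp_stabilizes S B (feedback lam B)"
  shows "\<exists>T>0. \<exists>\<delta>>0. \<forall>y.
    integral {0..T} (\<lambda>t. \<bar>BJ B (blinfun_apply (S t) y)\<bar>) \<ge> \<delta> * (norm (blinfun_apply (S T) y))\<^sup>2"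
proof -
  have C0: "C0_semigroup S"
    using assms(1) by (simp add: generates_C0_semigroup_def)
  have lip: "\<bar>BJ B x - BJ B y\<bar> \<le> C * m * norm (x - y)" if "norm x \<le> m" "norm y \<le> m" for x y m
  proof -
    have "0 \<le> m"
      using that(1) norm_ge_zero[of x] by linarith
    have "K (norm x) (norm y) \<le> K m m"
      using that by (intro assms(6)) auto
    also have "\<dots> \<le> C * m"
      using \<open>0 \<le> m\<close> by (rule assms(9))
    finally show ?thesis
      using assms(4)[of x y] by (meson mult_right_mono norm_ge_zero order_trans)
  qed
  obtain lam M \<sigma> where "0 < lam" "0 < M" "0 < \<sigma>"
    and stab: "\<And>y. \<exists>z. mild_solution S B (feedback lam B) y z \<and>
        (\<forall>t\<ge>0. norm (z t) \<le> M * exp (- \<sigma> * t) * norm y)"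
  proof -
    obtain lam where "0 < lam" and "unif_exp_stabilizes S B (feedback lam B)"
      using assms(10) by auto
    moreover from this(2) obtain M \<sigma> where "0 < M" "0 < \<sigma>"
      and M: "\<forall>y. \<exists>z. mild_solution S B (feedback lam B) y z \<and>
        (\<forall>w. mild_solution S B (feedback lam B) y w \<longrightarrow> (\<forall>t\<ge>0. w t = z t)) \<and>
        (\<forall>t\<ge>0. norm (z t) \<le> M * exp (- \<sigma> * t) * norm y)"
      unfolding unif_exp_stabilizes_def by (elim exE conjE)
    moreover have "\<exists>z. mild_solution S B (feedback lam B) y z \<and>
        (\<forall>t\<ge>0. norm (z t) \<le> M * exp (- \<sigma> * t) * norm y)" for y
      using spec[OF M, of y] by (elim exE conjE) (intro exI conjI)
    ultimately show ?thesis
      by (intro that)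
  qed
  define a where "a = lam * norm B + 1"
  have a: "lam * norm B \<le> a" "0 < a"
    using \<open>0 < lam\<close> by (auto simp: a_def intro: add_nonneg_pos)
  \<comment> \<open>Any \<open>T > 0\<close> with \<open>M * exp (- \<sigma> * T) \<le> 1 / 2\<close> would do; the absolute value allows for \<open>2 * M < 1\<close>.\<close>
  define T where "T = (\<bar>ln (2 * M)\<bar> + 1) / \<sigma>"
  have "0 < T"
    using \<open>0 < \<sigma>\<close> by (simp add: T_def add_nonneg_pos)
  have "exp (- \<sigma> * T) \<le> exp (- ln (2 * M))"
    using \<open>0 < \<sigma>\<close> by (simp add: T_def)
  then have halved: "M * exp (- \<sigma> * T) \<le> 1 / 2"
    using \<open>0 < M\<close> by (simp add: exp_minus field_simps)
  have "exp (- (3 * a * C * T)) / (4 * a) * (norm (S T y))\<^sup>2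
      \<le> integral {0..T} (\<lambda>t. \<bar>BJ B (S t y)\<bar>)" for y
  proof -
    obtain z where z: "mild_solution S B (feedback lam B) y z"
      and "norm (z T) \<le> M * exp (- \<sigma> * T) * norm y"
      using stab[of y] \<open>0 < T\<close> by (meson less_imp_le)
    then have "norm (z T) \<le> norm y / 2"
      using mult_right_mono[OF halved norm_ge_zero[of y]] by simp
    then have "exp (- (3 * a * C * T)) / (4 * a) * (norm y)\<^sup>2
        \<le> integral {0..T} (\<lambda>t. \<bar>BJ B (S t y)\<bar>)"
      using \<open>0 < C\<close> \<open>0 < lam\<close> \<open>0 < T\<close>
      by (intro observability_of_decaying_solution[OF C0 assms(2) lip _ z _ a]) auto
    moreover have "norm (S T y) = norm y"
      using assms(2) \<open>0 < T\<close> by (simp add: isometric_semigroup_def)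
    ultimately show ?thesis by simp
  qed
  moreover have "0 < exp (- (3 * a * C * T)) / (4 * a)"
    using a by simp
  ultimately show ?thesis
    using \<open>0 < T\<close> by blast
qed

end
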